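(* Let $I$ be a set, let $(G_j)_{j\in I}$ be a family of nontrivial groups, and let $G=\amalg_{j\in I}G_j$ be their free product, with each $G_j$ regarded as a subgroup of $G$. Let $i\in I$, let $N$ be a nontrivial normal subgroup of $G_i$, and let $H$ be the normal closure of $N$ in $G$. Then there is a subgroup $K$ of $H$ such that $H=N\amalg K$. Moreover, $K$ is unique up to isomorphism: if $K$ and $K'$ are subgroups of $H$ with $H=N\amalg K$ and $H=N\amalg K'$, then $K\cong K'$.
   Context: The free product $\amalg_{j\in I}G_j$ of nontrivial groups $G_j$ is a group $G$ containing all the $G_j$ as subgroups such that each element of $G$ can be uniquely represented as a reduced word, i.e. as the expression $1$ or as an expression $a_1a_2\cdots a_k$ with $k>0$, $a_m\in G_{\beta(m)}$, $a_m\neq 1$ for $1\le m\le k$, and $\beta(m)\neq\beta(m+1)$ for $1\le m\le k-1$. It exists, is unique up to isomorphism, and is the coproduct of the $G_j$ in the category of groups. The normal closure of a subgroup $N\le G$ in $G$ is the smallest normal subgroup of $G$ containing $N$. For subgroups $N,K$ of a group $H$, the equality $H=N\amalg K$ means that $H$ is the (internal) free product of $N$ and $K$, i.e. the homomorphism from the free product (coproduct) of $N$ and $K$ to $H$ induced by the inclusions $N\hookrightarrow H$ and $K\hookrightarrow H$ is an isomorphism; here $K$ is allowed to be trivial, in which case the equality means $H=N$. *)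

theory Defs
  imports "HOL-Algebra.Coset"
begin

section \<open>Reduced words and free products\<close>

text \<open>
  A letter is a pair of an index and an element of the factor with that index. Keeping the index
  in the letter is harmless for internal free products: if some \<open>a \<noteq> \<one>\<close> were in two
  factors, the words \<open>1\<close> and \<open>a a\<^sup>-\<^sup>1\<close> (with two different indices) would both represent
  \<open>\<one>\<close>, so uniqueness fails either way.
\<close>

definition reduced_words :: "'i set \<Rightarrow> ('i \<Rightarrow> ('a, 'c) monoid_scheme) \<Rightarrow> ('i \<times> 'a) list set" where
  "reduced_words I F =
    {w. set w \<subseteq> (SIGMA i:I. carrier (F i) - {\<one>\<^bsub>F i\<^esub>}) \<and> distinct_adj (map fst w)}"

fun letter_mult :: "('i \<Rightarrow> ('a, 'c) monoid_scheme) \<Rightarrow> 'i \<times> 'a \<Rightarrow> ('i \<times> 'a) list \<Rightarrow> ('i \<times> 'a) list" where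
  "letter_mult F (i, a) [] = (if a = \<one>\<^bsub>F i\<^esub> then [] else [(i, a)])"
| "letter_mult F (i, a) ((j, b) # w) =
    (if a = \<one>\<^bsub>F i\<^esub> then (j, b) # w
     else if i \<noteq> j then (i, a) # (j, b) # w
     else if a \<otimes>\<^bsub>F i\<^esub> b = \<one>\<^bsub>F i\<^esub> then w
     else (i, a \<otimes>\<^bsub>F i\<^esub> b) # w)"

text \<open>
  The free product (coproduct) of a family of possibly trivial groups, on the set of
  reduced words; a trivial factor contributes no letters. That this is the coproduct is shown in
  \<open>group_free_product\<close>, \<open>free_product_inj_hom\<close>, \<open>free_product_lift_hom\<close>,
  \<open>free_product_lift_inj\<close> and \<open>free_product_lift_unique\<close> below.
\<close>

definition free_product :: "'i set \<Rightarrow> ('i \<Rightarrow> ('a, 'c) monoid_scheme) \<Rightarrow> ('i \<times> 'a) list monoid" where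
  "free_product I F =
    \<lparr>carrier = reduced_words I F, monoid.mult = foldr (letter_mult F), one = []\<rparr>"

definition free_product_inj :: "('i \<Rightarrow> ('a, 'c) monoid_scheme) \<Rightarrow> 'i \<Rightarrow> 'a \<Rightarrow> ('i \<times> 'a) list" where
  "free_product_inj F i a = letter_mult F (i, a) []"

definition free_product_lift ::
    "('b, 'd) monoid_scheme \<Rightarrow> ('i \<Rightarrow> 'a \<Rightarrow> 'b) \<Rightarrow> ('i \<times> 'a) list \<Rightarrow> 'b" where
  "free_product_lift H \<phi> w = foldr (\<lambda>(i, a) x. \<phi> i a \<otimes>\<^bsub>H\<^esub> x) w \<one>\<^bsub>H\<^esub>"

definition is_free_product :: "('a, 'c) monoid_scheme \<Rightarrow> 'i set \<Rightarrow> ('i \<Rightarrow> 'a set) \<Rightarrow> bool" where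
  "is_free_product G I S \<longleftrightarrow>
    group G \<and> (\<forall>i\<in>I. subgroup (S i) G) \<and>
    (\<forall>g\<in>carrier G. \<exists>!w. w \<in> reduced_words I (\<lambda>i. G\<lparr>carrier := S i\<rparr>) \<and>
                         free_product_lift G (\<lambda>i a. a) w = g)"

text \<open>\<open>H = N \<amalg> K\<close>: the homomorphism from the coproduct induced by the two inclusions is an isomorphism.\<close>

definition is_free_product2 :: "('a, 'c) monoid_scheme \<Rightarrow> 'a set \<Rightarrow> 'a set \<Rightarrow> bool" where
  "is_free_product2 H N K \<longleftrightarrow>
    free_product_lift H (\<lambda>b a. a)
      \<in> iso (free_product (UNIV :: bool set) (\<lambda>b. H\<lparr>carrier := (if b then N else K)\<rparr>)) H"

definition normal_closure :: "('a, 'c) monoid_scheme \<Rightarrow> 'a set \<Rightarrow> 'a set" where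
  "normal_closure G N = \<Inter> {M. M \<lhd> G \<and> N \<subseteq> M}"


section \<open>The reduced-word construction is the coproduct\<close>

lemma reduced_words_Nil [simp]: "[] \<in> reduced_words I F"
  by (simp add: reduced_words_def)

lemma reduced_words_Cons:
  "(i, a) # w \<in> reduced_words I F \<longleftrightarrow>
     i \<in> I \<and> a \<in> carrier (F i) \<and> a \<noteq> \<one>\<^bsub>F i\<^esub> \<and> w \<in> reduced_words I F \<and> (w = [] \<or> fst (hd w) \<noteq> i)"
  by (cases w) (auto simp: reduced_words_def)

lemma letter_mult_one [simp]: "letter_mult F (i, \<one>\<^bsub>F i\<^esub>) w = w"
  by (cases "(F, (i, \<one>\<^bsub>F i\<^esub>), w)" rule: letter_mult.cases) auto

lemma letter_mult_Cons:
  "(i, a) # w \<in> reduced_words I F \<Longrightarrow> letter_mult F (i, a) w = (i, a) # w"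
  by (cases w) (auto simp: reduced_words_Cons)

context
  fixes I :: "'i set" and F :: "'i \<Rightarrow> ('a, 'c) monoid_scheme"
  assumes G: "\<And>i. i \<in> I \<Longrightarrow> group (F i)"
begin

lemma letter_mult_closed:
  assumes "i \<in> I" "a \<in> carrier (F i)" "w \<in> reduced_words I F"
  shows "letter_mult F (i, a) w \<in> reduced_words I F"
proof (cases w)
  case Nil
  then show ?thesis using assms by (simp add: reduced_words_Cons)
next
  case (Cons x v)
  obtain j b where x: "x = (j, b)" by (cases x)
  interpret group "F i" using G assms by blast
  have "a \<otimes>\<^bsub>F i\<^esub> b \<in> carrier (F i)" if "i = j"
  proof (rule m_closed)
    show "a \<in> carrier (F i)" by fact
    show "b \<in> carrier (F i)" using assms Cons x that by (simp add: reduced_words_Cons)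
  qed
  then show ?thesis using assms Cons x by (auto simp: reduced_words_Cons)
qed

lemma letter_mult_mult:
  assumes i: "i \<in> I"
    and ab: "a \<in> carrier (F i)" "b \<in> carrier (F i)" and w: "w \<in> reduced_words I F"
  shows "letter_mult F (i, a \<otimes>\<^bsub>F i\<^esub> b) w = letter_mult F (i, a) (letter_mult F (i, b) w)"
proof -
  interpret group "F i" using G i by blast
  have aux: "letter_mult F (i, d \<otimes>\<^bsub>F i\<^esub> c) v = letter_mult F (i, d) ((i, c) # v)"
    if "(i, c) # v \<in> reduced_words I F" for c d v
  proof (cases "d = \<one>\<^bsub>F i\<^esub>")
    case True
    then show ?thesis using that letter_mult_Cons[OF that] by (simp add: reduced_words_Cons)
  next
    case False
    have hd: "v = [] \<or> fst (hd v) \<noteq> i" using that by (simp add: reduced_words_Cons)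
    show ?thesis
      using False hd by (cases v) auto
  qed
  consider "b = \<one>\<^bsub>F i\<^esub>" | "b \<noteq> \<one>\<^bsub>F i\<^esub>" "w = [] \<or> fst (hd w) \<noteq> i"
    | c v where "b \<noteq> \<one>\<^bsub>F i\<^esub>" "w = (i, c) # v"
    by (cases w) force+
  then show ?thesis
  proof cases
    case 1
    then show ?thesis using ab by simp
  next
    case 2
    then have r: "(i, b) # w \<in> reduced_words I F"
      using i ab w by (auto simp: reduced_words_Cons)
    then show ?thesis using aux[OF r, of a] by (simp add: letter_mult_Cons)
  next
    case 3
    have c: "c \<in> carrier (F i)" "c \<noteq> \<one>\<^bsub>F i\<^esub>" and v: "v \<in> reduced_words I F"
      and hd: "v = [] \<or> fst (hd v) \<noteq> i"
      using w 3 by (auto simp: reduced_words_Cons)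
    have R: "letter_mult F (i, d) w = letter_mult F (i, d \<otimes>\<^bsub>F i\<^esub> c) v" for d
      using aux[of c v d] 3 w hd
      by simp
    show ?thesis
    proof (cases "b \<otimes>\<^bsub>F i\<^esub> c = \<one>\<^bsub>F i\<^esub>")
      case True
      then have "letter_mult F (i, a \<otimes>\<^bsub>F i\<^esub> b) w = letter_mult F (i, a) v"
        using ab c by (simp add: R[of "a \<otimes>\<^bsub>F i\<^esub> b"] m_assoc)
      then show ?thesis using 3 True by simp
    next
      case False
      then have r: "(i, b \<otimes>\<^bsub>F i\<^esub> c) # v \<in> reduced_words I F"
        using i ab c v hd by (auto simp: reduced_words_Cons)
      have "letter_mult F (i, a \<otimes>\<^bsub>F i\<^esub> b) w = letter_mult F (i, a) ((i, b \<otimes>\<^bsub>F i\<^esub> c) # v)"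
        using aux[OF r, of a] R[of "a \<otimes>\<^bsub>F i\<^esub> b"] ab c by (simp only: m_assoc)
      then show ?thesis using 3 False by simp
    qed
  qed
qed

lemma foldr_letter_mult_closed:
  assumes "u \<in> reduced_words I F" "v \<in> reduced_words I F"
  shows "foldr (letter_mult F) u v \<in> reduced_words I F"
  using assms
  by (induction u) (auto simp: reduced_words_Cons intro!: letter_mult_closed)

lemma foldr_letter_mult_letter_mult:
  assumes i: "i \<in> I" "a \<in> carrier (F i)"
    and v: "v \<in> reduced_words I F" and w: "w \<in> reduced_words I F"
  shows "foldr (letter_mult F) (letter_mult F (i, a) v) w
       = letter_mult F (i, a) (foldr (letter_mult F) v w)"
proof (cases v)
  case Nil
  then show ?thesis by simp
next
  case (Cons x v')
  obtain j b where x: "x = (j, b)" by (cases x)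
  have b: "b \<in> carrier (F j)" "j \<in> I" "v' \<in> reduced_words I F"
    using v Cons x by (auto simp: reduced_words_Cons)
  have r: "foldr (letter_mult F) v' w \<in> reduced_words I F"
    using foldr_letter_mult_closed b w by blast
  show ?thesis
    using Cons x b letter_mult_mult[OF i(1) i(2), of b] r
      letter_mult_one[of F i "foldr (letter_mult F) v' w"]
    by auto
qed

lemma group_free_product: "group (free_product I F)"
proof (rule groupI)
  show "x \<otimes>\<^bsub>free_product I F\<^esub> y \<in> carrier (free_product I F)"
    if "x \<in> carrier (free_product I F)" "y \<in> carrier (free_product I F)" for x y
    using that foldr_letter_mult_closed[of x y] by (simp add: free_product_def)
  show "x \<otimes>\<^bsub>free_product I F\<^esub> y \<otimes>\<^bsub>free_product I F\<^esub> z
      = x \<otimes>\<^bsub>free_product I F\<^esub> (y \<otimes>\<^bsub>free_product I F\<^esub> z)"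
    if "x \<in> carrier (free_product I F)" "y \<in> carrier (free_product I F)"
      "z \<in> carrier (free_product I F)" for x y z
  proof -
    have y: "y \<in> reduced_words I F" and z: "z \<in> reduced_words I F"
      using that by (simp_all add: free_product_def)
    have "x \<in> reduced_words I F \<Longrightarrow> foldr (letter_mult F) (foldr (letter_mult F) x y) z
        = foldr (letter_mult F) x (foldr (letter_mult F) y z)"
    proof (induction x)
      case (Cons p x)
      obtain i a where p: "p = (i, a)" by (cases p)
      have "i \<in> I" "a \<in> carrier (F i)" "x \<in> reduced_words I F"
        using Cons.prems p by (auto simp: reduced_words_Cons)
      then show ?case
        using Cons.IH foldr_letter_mult_letter_mult[of i a "foldr (letter_mult F) x y" z] p
          foldr_letter_mult_closed[OF _ y] z by simp
    qed simp
    then show ?thesis using that by (simp add: free_product_def)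
  qed
  show "\<exists>y\<in>carrier (free_product I F). y \<otimes>\<^bsub>free_product I F\<^esub> x = \<one>\<^bsub>free_product I F\<^esub>"
    if "x \<in> carrier (free_product I F)" for x
  proof -
    have "x \<in> reduced_words I F \<Longrightarrow> \<exists>y\<in>reduced_words I F. foldr (letter_mult F) y x = []"
    proof (induction x)
      case Nil
      then show ?case by (intro bexI[of _ "[]"]) simp_all
    next
      case (Cons p x)
      obtain i a where p: "p = (i, a)" by (cases p)
      have i: "i \<in> I" "a \<in> carrier (F i)" "a \<noteq> \<one>\<^bsub>F i\<^esub>" and x: "x \<in> reduced_words I F"
        using Cons.prems p by (auto simp: reduced_words_Cons)
      interpret group "F i" using G i by blast
      obtain y where y: "y \<in> reduced_words I F" "foldr (letter_mult F) y x = []"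
        using Cons x by blast
      have l: "letter_mult F (i, inv\<^bsub>F i\<^esub> a) [] = [(i, inv\<^bsub>F i\<^esub> a)]"
        and r: "[(i, inv\<^bsub>F i\<^esub> a)] \<in> reduced_words I F"
        using i by (auto simp: reduced_words_Cons inv_eq_1_iff)
      let ?y = "foldr (letter_mult F) y [(i, inv\<^bsub>F i\<^esub> a)]"
      have px: "p # x \<in> reduced_words I F" using Cons.prems .
      have "u \<in> reduced_words I F \<Longrightarrow> foldr (letter_mult F) (foldr (letter_mult F) u [(i, inv\<^bsub>F i\<^esub> a)]) (p # x)
          = foldr (letter_mult F) u x" for u
      proof (induction u)
        case Nil
        then show ?case using i p l by (auto simp: inv_eq_1_iff)
      next
        case (Cons q u)
        obtain j b where q: "q = (j, b)" by (cases q)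
        have "j \<in> I" "b \<in> carrier (F j)" "u \<in> reduced_words I F"
          using Cons.prems q by (auto simp: reduced_words_Cons)
        then show ?case
          using Cons.IH q px
            foldr_letter_mult_letter_mult[of j b "foldr (letter_mult F) u [(i, inv\<^bsub>F i\<^esub> a)]" "p # x"]
            foldr_letter_mult_closed[OF _ r] by simp
      qed
      then have "foldr (letter_mult F) ?y (p # x) = []" using y by simp
      then show ?case using foldr_letter_mult_closed[OF y(1) r] by blast
    qed
    then show ?thesis using that by (auto simp: free_product_def)
  qed
qed (simp_all add: free_product_def)

lemma free_product_inj_hom:
  assumes i: "i \<in> I"
  shows "free_product_inj F i \<in> hom (F i) (free_product I F)"
proof (rule homI)
  show "free_product_inj F i a \<in> carrier (free_product I F)" if "a \<in> carrier (F i)" for a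
    using letter_mult_closed[OF i that reduced_words_Nil] by (simp del: letter_mult.simps add: free_product_inj_def free_product_def)
  show "free_product_inj F i (a \<otimes>\<^bsub>F i\<^esub> b)
      = free_product_inj F i a \<otimes>\<^bsub>free_product I F\<^esub> free_product_inj F i b"
    if "a \<in> carrier (F i)" "b \<in> carrier (F i)" for a b
  proof -
    have "foldr (letter_mult F) (letter_mult F (i, a) []) w = letter_mult F (i, a) w" for w
      by (cases "a = \<one>\<^bsub>F i\<^esub>") simp_all
    then show ?thesis
      using letter_mult_mult[OF i that, of "[]"]
      by (simp del: letter_mult.simps add: free_product_inj_def free_product_def)
  qed
qed

lemma free_product_lift_closed:
  assumes "group H" "\<And>i. i \<in> I \<Longrightarrow> \<phi> i \<in> hom (F i) H" "w \<in> reduced_words I F"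
  shows "free_product_lift H \<phi> w \<in> carrier H"
proof -
  interpret group H by fact
  show ?thesis
    using assms(3)
  proof (induction w)
    case (Cons p w)
    then show ?case
      using hom_in_carrier[OF assms(2)]
      by (cases p) (auto simp: free_product_lift_def reduced_words_Cons)
  qed (simp add: free_product_lift_def)
qed

lemma free_product_lift_letter_mult:
  assumes H: "group H"
    and \<phi>: "\<And>i. i \<in> I \<Longrightarrow> \<phi> i \<in> hom (F i) H"
    and i: "i \<in> I" "a \<in> carrier (F i)" and w: "w \<in> reduced_words I F"
  shows "free_product_lift H \<phi> (letter_mult F (i, a) w) = \<phi> i a \<otimes>\<^bsub>H\<^esub> free_product_lift H \<phi> w"
proof -
  interpret group H by fact
  have one: "\<phi> i \<one>\<^bsub>F i\<^esub> = \<one>\<^bsub>H\<^esub>" using hom_one[OF \<phi>[OF i(1)] G[OF i(1)] H] .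
  have c: "\<phi> i a \<in> carrier H" using hom_in_carrier[OF \<phi>] i by blast
  show ?thesis
  proof (cases w)
    case Nil
    then show ?thesis using one c by (simp add: free_product_lift_def)
  next
    case (Cons p v)
    obtain j b where p: "p = (j, b)" by (cases p)
    have b: "j \<in> I" "b \<in> carrier (F j)" and v: "v \<in> reduced_words I F"
      using w Cons p by (auto simp: reduced_words_Cons)
    have V: "free_product_lift H \<phi> v \<in> carrier H" by (rule free_product_lift_closed[OF H \<phi> v])
    have bc: "\<phi> j b \<in> carrier H" using hom_in_carrier[OF \<phi>] b by blast
    have m: "\<phi> i (a \<otimes>\<^bsub>F i\<^esub> b) = \<phi> i a \<otimes>\<^bsub>H\<^esub> \<phi> i b" if "i = j"
      using hom_mult[OF \<phi>[OF i(1)]] i b that by blast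
    have C: "free_product_lift H \<phi> ((k, d) # u) = \<phi> k d \<otimes>\<^bsub>H\<^esub> free_product_lift H \<phi> u" for k d u
      by (simp add: free_product_lift_def)
    have s: "\<phi> i a \<otimes>\<^bsub>H\<^esub> (\<phi> j b \<otimes>\<^bsub>H\<^esub> free_product_lift H \<phi> v)
        = (\<phi> i a \<otimes>\<^bsub>H\<^esub> \<phi> j b) \<otimes>\<^bsub>H\<^esub> free_product_lift H \<phi> v"
      using c bc V by (simp add: m_assoc)
    show ?thesis
    proof (cases "i = j")
      case True
      then show ?thesis
        using one Cons p C m[OF True] c bc V s by (auto simp: one)
    next
      case False
      then show ?thesis using one Cons p C c bc V by auto
    qed
  qed
qed

lemma free_product_lift_hom:
  assumes H: "group H"
    and \<phi>: "\<And>i. i \<in> I \<Longrightarrow> \<phi> i \<in> hom (F i) H"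
  shows "free_product_lift H \<phi> \<in> hom (free_product I F) H"
proof (rule homI)
  interpret group H by fact
  show "free_product_lift H \<phi> x \<in> carrier H" if "x \<in> carrier (free_product I F)" for x
    using that free_product_lift_closed[OF H \<phi>] by (simp add: free_product_def)
  show "free_product_lift H \<phi> (x \<otimes>\<^bsub>free_product I F\<^esub> y)
      = free_product_lift H \<phi> x \<otimes>\<^bsub>H\<^esub> free_product_lift H \<phi> y"
    if "x \<in> carrier (free_product I F)" "y \<in> carrier (free_product I F)" for x y
  proof -
    have y: "y \<in> reduced_words I F" using that by (simp add: free_product_def)
    have Y: "free_product_lift H \<phi> y \<in> carrier H" by (rule free_product_lift_closed[OF H \<phi> y])
    have "x \<in> reduced_words I F \<Longrightarrow> free_product_lift H \<phi> (foldr (letter_mult F) x y)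
        = free_product_lift H \<phi> x \<otimes>\<^bsub>H\<^esub> free_product_lift H \<phi> y"
    proof (induction x)
      case Nil
      then show ?case using Y by (simp add: free_product_lift_def)
    next
      case (Cons p x)
      obtain i a where p: "p = (i, a)" by (cases p)
      have i: "i \<in> I" "a \<in> carrier (F i)" and x: "x \<in> reduced_words I F"
        using Cons.prems p by (auto simp: reduced_words_Cons)
      have X: "free_product_lift H \<phi> x \<in> carrier H" by (rule free_product_lift_closed[OF H \<phi> x])
      have A: "\<phi> i a \<in> carrier H" using hom_in_carrier[OF \<phi>] i by blast
      have C: "free_product_lift H \<phi> (p # x) = \<phi> i a \<otimes>\<^bsub>H\<^esub> free_product_lift H \<phi> x"
        by (simp add: free_product_lift_def p)
      have "free_product_lift H \<phi> (foldr (letter_mult F) (p # x) y)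
          = \<phi> i a \<otimes>\<^bsub>H\<^esub> (free_product_lift H \<phi> x \<otimes>\<^bsub>H\<^esub> free_product_lift H \<phi> y)"
        using free_product_lift_letter_mult[OF H \<phi> i foldr_letter_mult_closed[OF x y]]
          Cons.IH[OF x] p by simp
      then show ?case using C A X Y by (simp add: m_assoc)
    qed
    then show ?thesis using that by (simp add: free_product_def)
  qed
qed

lemma free_product_lift_inj:
  assumes "group H" "\<And>i. i \<in> I \<Longrightarrow> \<phi> i \<in> hom (F i) H"
    and "i \<in> I" "a \<in> carrier (F i)"
  shows "free_product_lift H \<phi> (free_product_inj F i a) = \<phi> i a"
proof -
  interpret group H by fact
  have "\<phi> i a \<in> carrier H" using assms hom_in_carrier by metis
  then show ?thesis
    using free_product_lift_letter_mult[OF assms, of "[]"]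
    by (simp add: free_product_inj_def free_product_lift_def)
qed

lemma free_product_lift_unique:
  assumes H: "group H"
    and h: "h \<in> hom (free_product I F) H"
    and ext: "\<And>i a. i \<in> I \<Longrightarrow> a \<in> carrier (F i) \<Longrightarrow> h (free_product_inj F i a) = \<phi> i a"
    and w: "w \<in> carrier (free_product I F)"
  shows "h w = free_product_lift H \<phi> w"
proof -
  have "w \<in> reduced_words I F" using w by (simp add: free_product_def)
  then show ?thesis
  proof (induction w)
    case Nil
    then show ?case
      using hom_one[OF h group_free_product H]
      by (simp add: free_product_def free_product_lift_def)
  next
    case (Cons p w)
    obtain i a where p: "p = (i, a)" by (cases p)
    have i: "i \<in> I" "a \<in> carrier (F i)" "a \<noteq> \<one>\<^bsub>F i\<^esub>" and w: "w \<in> reduced_words I F"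
      using Cons.prems p by (auto simp: reduced_words_Cons)
    have "p # w = free_product_inj F i a \<otimes>\<^bsub>free_product I F\<^esub> w"
      using i p letter_mult_Cons[of i a w I F] Cons.prems
      by (simp add: free_product_inj_def free_product_def)
    moreover have "free_product_inj F i a \<in> carrier (free_product I F)"
      using hom_in_carrier[OF free_product_inj_hom[OF i(1)] i(2)] by simp
    ultimately have "h (p # w) = \<phi> i a \<otimes>\<^bsub>H\<^esub> h w"
      using hom_mult[OF h] ext i w by (simp add: free_product_def)
    then show ?case using Cons.IH[OF w] p by (simp add: free_product_lift_def)
  qed
qed

end

end

theory Submission
  imports Defs "HOL-Algebra.Generated_Groups"
begin

text \<open>
  Uniqueness of the complement. If \<open>H = N \<amalg> K\<close>, there is a retraction of \<open>H\<close> onto \<open>K\<close> which kills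
  \<open>N\<close>. Given two complements \<open>K\<close> and \<open>K'\<close> with retractions \<open>r\<close> and \<open>r'\<close>, the endomorphisms
  \<open>r \<circ> r'\<close> and \<open>r\<close> both kill \<open>N\<close> and agree on \<open>K'\<close>, hence they are equal; so \<open>r (r' k) = r k = k\<close>
  for \<open>k \<in> K\<close>, and symmetrically. Thus \<open>r'\<close> and \<open>r\<close> restrict to mutually inverse isomorphisms
  between \<open>K\<close> and \<open>K'\<close> (both being copies of \<open>H\<close> modulo the normal closure of \<open>N\<close>); this is
  \<open>free_product2_complement_unique\<close>.

  Existence. Choose a transversal of \<open>N\<close> in \<open>G\<^sub>i\<close> containing \<open>1\<close>. Let \<open>T\<close> be the set of reduced
  words which do not end in an \<open>i\<close>-letter and all of whose \<open>i\<close>-letters lie in the transversal.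
  These words represent the double cosets \<open>H g G\<^sub>i\<close>, and \<open>H\<close> is the free product of the
  conjugates \<open>t N t\<^sup>-\<^sup>1\<close> for \<open>t \<in> T\<close>: that is the shape given by the action of \<open>H\<close> on the Bass-Serre
  tree of \<open>G\<close>, whose quotient is the Bass-Serre tree of \<open>G/H\<close>. The complement \<open>K\<close> is generated by the
  conjugates with \<open>t \<noteq> 1\<close>.

  The freeness is proved by ping-pong. Let \<open>X t\<close> be the set of elements whose reduced word
  starts with \<open>t\<close> followed by an \<open>i\<close>-letter outside the transversal. The sets \<open>X t\<close> are disjoint,
  since \<open>t\<close> is recovered as the part before the first letter outside the transversal, and every
  nontrivial element of \<open>t N t\<^sup>-\<^sup>1\<close> maps the complement of \<open>X t\<close> into \<open>X t\<close>
  (\<open>conj_moves_into_X\<close>). A first round of ping-pong shows that nontrivial elements of \<open>K\<close> map the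
  complement of the union of the \<open>X t\<close> with \<open>t \<noteq> 1\<close> into that union (\<open>K_moves_into_X\<close>), and a second round with \<open>N\<close> and \<open>K\<close> shows that
  \<open>N \<amalg> K \<rightarrow> G\<close> is injective (\<open>ev2_inj\<close>).

  It remains to see that the image \<open>M\<close> of \<open>N \<amalg> K\<close> is the normal closure. Reading a word from left
  to right and splitting each \<open>i\<close>-letter into an element of \<open>N\<close> and a transversal element shows that every element of \<open>G\<close> is
  \<open>m v\<close> with \<open>m \<in> M\<close> and \<open>v\<close> a word with all \<open>i\<close>-letters in the transversal (\<open>M_W_cover\<close>). Since \<open>N\<close> is
  normal in \<open>G\<^sub>i\<close>, all conjugates of \<open>N\<close> then lie in \<open>M\<close> (\<open>conj_N_in_M\<close>).
\<close>

section \<open>Ping-pong and homomorphisms from free products\<close>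

text \<open>
  The letters of a reduced word act from right to left; since consecutive letters have different
  indices and the sets are disjoint, each letter finds its argument outside its own set and
  pushes it in. The start \<open>g\<close> must lie outside all the sets, since the last letter is arbitrary.
\<close>
lemma ping_pong:
  assumes H: "group H" and F: "\<And>j. j \<in> J \<Longrightarrow> group (F j)"
    and \<phi>: "\<And>j. j \<in> J \<Longrightarrow> \<phi> j \<in> hom (F j) H"
    and move: "\<And>j a g. j \<in> J \<Longrightarrow> a \<in> carrier (F j) \<Longrightarrow> a \<noteq> \<one>\<^bsub>F j\<^esub> \<Longrightarrow> g \<in> carrier H \<Longrightarrow> g \<notin> X j
                \<Longrightarrow> \<phi> j a \<otimes>\<^bsub>H\<^esub> g \<in> X j"
    and disj: "\<And>j k. j \<in> J \<Longrightarrow> k \<in> J \<Longrightarrow> j \<noteq> k \<Longrightarrow> X j \<inter> X k = {}"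
    and g: "g \<in> carrier H" "\<And>j. j \<in> J \<Longrightarrow> g \<notin> X j"
    and w: "w \<in> reduced_words J F" "w \<noteq> []"
  shows "free_product_lift H \<phi> w \<otimes>\<^bsub>H\<^esub> g \<in> X (fst (hd w))"
  using w
proof (induction w)
  case Nil
  then show ?case by simp
next
  case (Cons p w)
  interpret group H by fact
  obtain j a where p: "p = (j, a)" by (cases p)
  have j: "j \<in> J" "a \<in> carrier (F j)" "a \<noteq> \<one>\<^bsub>F j\<^esub>" and w: "w \<in> reduced_words J F"
    and hd: "w = [] \<or> fst (hd w) \<noteq> j"
    using Cons.prems p by (auto simp: reduced_words_Cons)
  let ?h = "free_product_lift H \<phi> w"
  have h: "?h \<in> carrier H" using free_product_lift_closed[OF F H \<phi> w] .
  have a: "\<phi> j a \<in> carrier H" using hom_in_carrier[OF \<phi>] j by blast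
  have "?h \<otimes>\<^bsub>H\<^esub> g \<notin> X j"
  proof (cases "w = []")
    case True
    then show ?thesis using g j by (simp add: free_product_lift_def)
  next
    case False
    have "fst (hd w) \<in> J"
      using w False by (cases w) (auto simp: reduced_words_def)
    then show ?thesis using Cons.IH[OF w False] hd False disj[of "fst (hd w)" j] j by blast
  qed
  then have "\<phi> j a \<otimes>\<^bsub>H\<^esub> (?h \<otimes>\<^bsub>H\<^esub> g) \<in> X j" using move j h g by simp
  then show ?case using p a h g by (simp add: free_product_lift_def m_assoc)
qed

lemma free_product_lift_trivial_kernel_inj:
  assumes H: "group H" and F: "\<And>j. j \<in> J \<Longrightarrow> group (F j)"
    and \<phi>: "\<And>j. j \<in> J \<Longrightarrow> \<phi> j \<in> hom (F j) H"
    and ker: "\<And>w. w \<in> reduced_words J F \<Longrightarrow> w \<noteq> [] \<Longrightarrow> free_product_lift H \<phi> w \<noteq> \<one>\<^bsub>H\<^esub>"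
  shows "inj_on (free_product_lift H \<phi>) (reduced_words J F)"
proof -
  have P: "group (free_product J F)" by (rule group_free_product) (rule F)
  have l: "free_product_lift H \<phi> \<in> hom (free_product J F) H"
    by (rule free_product_lift_hom[OF F H \<phi>])
  interpret group_hom "free_product J F" H "free_product_lift H \<phi>"
    using P H l by (simp add: group_hom_def group_hom_axioms_def)
  have "kernel (free_product J F) H (free_product_lift H \<phi>) = {\<one>\<^bsub>free_product J F\<^esub>}"
  proof -
    have "free_product_lift H \<phi> [] = \<one>\<^bsub>H\<^esub>" by (simp add: free_product_lift_def)
    then show ?thesis using ker by (auto simp: kernel_def free_product_def)
  qed
  from trivial_ker_imp_inj[OF this] show ?thesis by (simp add: free_product_def)
qed

lemma free_product_lift_in_subgroup:
  assumes L: "subgroup L H" and w: "w \<in> reduced_words J F"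
    and \<phi>: "\<And>j a. j \<in> J \<Longrightarrow> a \<in> carrier (F j) \<Longrightarrow> \<phi> j a \<in> L"
  shows "free_product_lift H \<phi> w \<in> L"
  using w
proof (induction w)
  case Nil
  then show ?case using subgroup.one_closed[OF L] by (simp add: free_product_lift_def)
next
  case (Cons p w)
  then show ?case
    using \<phi> subgroup.m_closed[OF L]
    by (cases p) (auto simp: reduced_words_Cons free_product_lift_def)
qed

section \<open>Uniqueness of the complement\<close>

text \<open>
  Composed with the isomorphism from the coproduct, both maps extend the same pair of maps on \<open>N\<close>
  and \<open>K\<close>, and such an extension is unique.
\<close>
lemma hom_eq_on_free_product2:
  assumes H: "group H" and L: "group L"
    and N: "subgroup N H" and K: "subgroup K H" and fp: "is_free_product2 H N K"
    and f: "f \<in> hom H L" and f': "f' \<in> hom H L"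
    and eqN: "\<And>n. n \<in> N \<Longrightarrow> f n = f' n" and eqK: "\<And>k. k \<in> K \<Longrightarrow> f k = f' k"
    and x: "x \<in> carrier H"
  shows "f x = f' x"
proof -
  let ?F = "\<lambda>b. H\<lparr>carrier := (if b then N else K)\<rparr>"
  let ?l = "free_product_lift H (\<lambda>b a. a)"
  interpret H: group H by fact
  have F: "group (?F b)" for b
    using H.subgroup_imp_group N K by simp
  have l: "?l \<in> hom (free_product UNIV ?F) H" and im: "?l ` reduced_words UNIV ?F = carrier H"
    using fp by (auto simp: is_free_product2_def iso_def bij_betw_def free_product_def)
  have incl: "(\<lambda>a. a) \<in> hom (?F b) H" for b
    using N K by (auto intro!: homI dest: subgroup.mem_carrier)
  have li: "?l (free_product_inj ?F b a) = a" if "a \<in> carrier (?F b)" for a b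
    by (rule free_product_lift_inj[where I = UNIV]) (use F H incl that in auto)
  have ext: "f' (?l (free_product_inj ?F b a)) = f a" "f (?l (free_product_inj ?F b a)) = f a"
    if "a \<in> carrier (?F b)" for a b
    using li[OF that] eqN eqK that by (auto split: if_splits)
  obtain w where w: "w \<in> carrier (free_product UNIV ?F)" "x = ?l w"
    using im x by (auto simp: free_product_def)
  have "(f \<circ> ?l) w = free_product_lift L (\<lambda>b. f) w"
    by (rule free_product_lift_unique[OF _ L hom_compose[OF l f] _ w(1)])
       (use F in simp, use ext in simp)
  moreover have "(f' \<circ> ?l) w = free_product_lift L (\<lambda>b. f) w"
    by (rule free_product_lift_unique[OF _ L hom_compose[OF l f'] _ w(1)])
       (use F in simp, use ext in simp)
  ultimately show ?thesis using w by simp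
qed

text \<open>
  Extend the trivial map on \<open>N\<close> and the identity on \<open>K\<close> to the coproduct, and transport the
  extension to \<open>H\<close> along the given isomorphism.
\<close>
lemma free_product2_retraction:
  assumes H: "group H" and N: "subgroup N H" and K: "subgroup K H"
    and fp: "is_free_product2 H N K"
  obtains r where "r \<in> hom H (H\<lparr>carrier := K\<rparr>)"
    "\<And>n. n \<in> N \<Longrightarrow> r n = \<one>\<^bsub>H\<^esub>" "\<And>k. k \<in> K \<Longrightarrow> r k = k"
proof -
  let ?F = "\<lambda>b. H\<lparr>carrier := (if b then N else K)\<rparr>"
  let ?P = "free_product (UNIV :: bool set) ?F"
  let ?l = "free_product_lift H (\<lambda>b a. a)"
  let ?L = "H\<lparr>carrier := K\<rparr>"
  let ?\<phi> = "\<lambda>b a. if b then \<one>\<^bsub>H\<^esub> else a"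
  interpret H: group H by fact
  have F: "group (?F b)" for b
    using H.subgroup_imp_group N K by simp
  have L: "group ?L" using H.subgroup_imp_group K by simp
  have P: "group ?P" using group_free_product[of UNIV ?F] F by simp
  have incl: "(\<lambda>a. a) \<in> hom (?F b) H" for b
    using N K by (auto intro!: homI dest: subgroup.mem_carrier)
  have \<phi>: "?\<phi> b \<in> hom (?F b) ?L" for b
    using N K by (auto intro!: homI simp: subgroup.one_closed)
  have li: "?l (free_product_inj ?F b a) = a" if "a \<in> carrier (?F b)" for a b
    by (rule free_product_lift_inj[where I = UNIV]) (use F H incl that in auto)
  have lin: "free_product_lift ?L ?\<phi> (free_product_inj ?F b a) = ?\<phi> b a"
    if "a \<in> carrier (?F b)" for a b
    by (rule free_product_lift_inj[where I = UNIV]) (use F L \<phi> that in auto)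
  have iso: "?l \<in> iso ?P H" using fp by (simp add: is_free_product2_def)
  let ?m = "inv_into (carrier ?P) ?l"
  have m: "?m \<in> hom H ?P" using group.iso_set_sym[OF P iso] by (simp add: iso_def)
  have inv: "?m a = free_product_inj ?F b a" if "a \<in> carrier (?F b)" for a b
  proof -
    have "free_product_inj ?F b a \<in> carrier ?P"
      using hom_in_carrier[OF free_product_inj_hom[of UNIV ?F b]] F that by simp
    moreover have "inj_on ?l (carrier ?P)"
      using iso by (simp add: iso_def bij_betw_def)
    ultimately have "?m (?l (free_product_inj ?F b a)) = free_product_inj ?F b a"
      by (rule inv_into_f_f[rotated])
    then show ?thesis by (simp only: li[OF that])
  qed
  show thesis
  proof (rule that)
    show "free_product_lift ?L ?\<phi> \<circ> ?m \<in> hom H ?L"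
      by (rule hom_compose[OF m free_product_lift_hom]) (use F L \<phi> in auto)
    show "(free_product_lift ?L ?\<phi> \<circ> ?m) n = \<one>\<^bsub>H\<^esub>" if "n \<in> N" for n
      using lin[of n True] inv[of n True] that by simp
    show "(free_product_lift ?L ?\<phi> \<circ> ?m) k = k" if "k \<in> K" for k
      using lin[of k False] inv[of k False] that by simp
  qed
qed

lemma free_product2_complement_unique:
  assumes H: "group H" and N: "subgroup N H"
    and K: "subgroup K H" "is_free_product2 H N K"
    and K': "subgroup K' H" "is_free_product2 H N K'"
  shows "H\<lparr>carrier := K\<rparr> \<cong> H\<lparr>carrier := K'\<rparr>"
proof -
  interpret H: group H by fact
  obtain r where r: "r \<in> hom H (H\<lparr>carrier := K\<rparr>)"
    "\<And>n. n \<in> N \<Longrightarrow> r n = \<one>\<^bsub>H\<^esub>" "\<And>k. k \<in> K \<Longrightarrow> r k = k"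
    using free_product2_retraction[OF H N K] by blast
  obtain r' where r': "r' \<in> hom H (H\<lparr>carrier := K'\<rparr>)"
    "\<And>n. n \<in> N \<Longrightarrow> r' n = \<one>\<^bsub>H\<^esub>" "\<And>k. k \<in> K' \<Longrightarrow> r' k = k"
    using free_product2_retraction[OF H N K'] by blast
  have sub: "K \<subseteq> carrier H" "K' \<subseteq> carrier H"
    using K K' by (auto dest: subgroup.mem_carrier)
  have into: "f \<in> hom H H" if "f \<in> hom H (H\<lparr>carrier := A\<rparr>)" "A \<subseteq> carrier H" for f A
    using that by (auto simp: hom_def)
  \<comment> \<open>\<open>s \<circ> s' = s\<close>: on \<open>N\<close> both are trivial, and on \<open>A'\<close> the map \<open>s'\<close> is the identity. It is used with
    the roles of the two complements exchanged, hence the general \<open>s\<close> and \<open>s'\<close>.\<close>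
  have absorb: "s (s' x) = s x"
    if s: "s \<in> hom H (H\<lparr>carrier := A\<rparr>)" "\<And>n. n \<in> N \<Longrightarrow> s n = \<one>\<^bsub>H\<^esub>" "A \<subseteq> carrier H"
      and s': "s' \<in> hom H (H\<lparr>carrier := A'\<rparr>)" "\<And>n. n \<in> N \<Longrightarrow> s' n = \<one>\<^bsub>H\<^esub>"
        "\<And>k. k \<in> A' \<Longrightarrow> s' k = k"
      and A': "subgroup A' H" "is_free_product2 H N A'" and x: "x \<in> carrier H" for s s' A A' x
  proof -
    have A'sub: "A' \<subseteq> carrier H" using A' by (auto dest: subgroup.mem_carrier)
    have 1: "s \<in> hom H H" using into s by blast
    have 2: "s' \<in> hom H H" using into s' A'sub by blast
    have 3: "s \<one>\<^bsub>H\<^esub> = \<one>\<^bsub>H\<^esub>" using hom_one[OF 1 H H] .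
    have "(s \<circ> s') x = s x"
      by (rule hom_eq_on_free_product2[OF H H N A' hom_compose[OF 2 1] 1 _ _ x])
         (use s s' 3 in auto)
    then show ?thesis by simp
  qed
  have "bij_betw r' K K'"
  proof (rule bij_betw_byWitness[of _ r])
    show "\<forall>k\<in>K. r (r' k) = k"
      using absorb[OF r(1,2) sub(1) r' K'] r(3) sub by auto
    show "\<forall>k\<in>K'. r' (r k) = k"
      using absorb[OF r'(1,2) sub(2) r K] r'(3) sub by auto
    show "r' ` K \<subseteq> K'" "r ` K' \<subseteq> K"
      using r(1) r'(1) sub by (auto simp: hom_def Pi_iff)
  qed
  moreover have "r' \<in> hom (H\<lparr>carrier := K\<rparr>) (H\<lparr>carrier := K'\<rparr>)"
    using r'(1) sub by (auto simp: hom_def Pi_iff subset_iff)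
  ultimately show ?thesis by (auto simp: is_iso_def iso_def)
qed

section \<open>A transversal of the normal subgroup\<close>

locale normal_subgroup_of_free_factor = group G for G (structure) +
  fixes I :: "'i set" and S :: "'i \<Rightarrow> 'a set" and i :: 'i and N :: "'a set"
  assumes fp: "is_free_product G I S"
    and iI: "i \<in> I"
    and N_normal: "N \<lhd> G\<lparr>carrier := S i\<rparr>"
begin

lemma S_subgroup: "j \<in> I \<Longrightarrow> subgroup (S j) G"
  using fp by (simp add: is_free_product_def)

lemma S_closed: "j \<in> I \<Longrightarrow> a \<in> S j \<Longrightarrow> a \<in> carrier G"
  by (rule subgroup.mem_carrier[OF S_subgroup])

lemma N_subgroup: "subgroup N G"
  using incl_subgroup[OF S_subgroup[OF iI] normal_imp_subgroup[OF N_normal]] .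

lemma N_sub_S: "n \<in> N \<Longrightarrow> n \<in> S i"
  using subgroup.mem_carrier[OF normal_imp_subgroup[OF N_normal]] by simp

lemma N_closed: "n \<in> N \<Longrightarrow> n \<in> carrier G"
  by (rule subgroup.mem_carrier[OF N_subgroup])

lemma N_conj:
  assumes "a \<in> S i" "n \<in> N"
  shows "a \<otimes> n \<otimes> inv a \<in> N"
  using normal.inv_op_closed2[OF N_normal, of a n] assms
    m_inv_consistent[OF S_subgroup[OF iI], of a] by simp


text \<open>
  The value depends on \<open>a\<close> only through its coset, and the coset \<open>N\<close> itself gets the representative
  \<open>\<one>\<close>; so a letter fixed by \<open>rep\<close> is never a nontrivial element of \<open>N\<close>.
\<close>
definition rep :: "'a \<Rightarrow> 'a" where
  "rep a = (if \<one> \<in> N #> a then \<one> else SOME x. x \<in> N #> a)"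

lemma rep_in_coset:
  assumes "a \<in> carrier G"
  shows "rep a \<in> N #> a"
  using rcos_self[OF assms N_subgroup] by (auto simp: rep_def intro: someI)

lemma rep_mult:
  assumes n: "n \<in> N" and a: "a \<in> carrier G"
  shows "rep (n \<otimes> a) = rep a"
proof -
  have "N #> (n \<otimes> a) = N #> a"
    using coset_mult_assoc[of N n a] coset_join2[OF N_closed[OF n] N_subgroup n]
      n a N_closed by (auto simp: subset_iff)
  then show ?thesis by (simp add: rep_def)
qed

lemma rep_one: "rep \<one> = \<one>"
  using rcos_self[OF one_closed N_subgroup] by (simp add: rep_def)

lemma rep_N: "n \<in> N \<Longrightarrow> rep n = \<one>"
  using rep_mult[of n \<one>] rep_one N_closed by simp

lemma rep_decomp:
  assumes a: "a \<in> S i"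
  obtains n where "n \<in> N" "a = n \<otimes> rep a" "rep a \<in> S i" "rep (rep a) = rep a"
proof -
  have ac: "a \<in> carrier G" using a S_closed iI by blast
  obtain m where m: "m \<in> N" "rep a = m \<otimes> a"
    using rep_in_coset[OF ac] by (auto simp: r_coset_def)
  have "inv m \<in> N" by (rule subgroup.m_inv_closed[OF N_subgroup m(1)])
  moreover have "a = inv m \<otimes> rep a"
    unfolding m(2) using m(1) ac N_closed by (simp add: m_assoc[symmetric])
  moreover have "rep a \<in> S i"
    unfolding m(2) by (rule subgroup.m_closed[OF S_subgroup[OF iI] N_sub_S[OF m(1)] a])
  moreover have "rep (rep a) = rep a"
    unfolding m(2) by (rule trans[OF rep_mult[OF m(1) ac] m(2)])
  ultimately show thesis by (rule that)
qed

text \<open>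
  Multiplication by a nontrivial element of \<open>N\<close> changes the element but not the coset, hence
  leaves the transversal. This is what makes the ping-pong work.
\<close>
lemma rep_moved:
  assumes n: "n \<in> N" "n \<noteq> \<one>" and a: "a \<in> carrier G" "rep a = a"
  shows "rep (n \<otimes> a) \<noteq> n \<otimes> a"
proof
  assume "rep (n \<otimes> a) = n \<otimes> a"
  then have "n \<otimes> a = a" by (metis rep_mult[OF n(1) a(1)] a(2))
  then show False using n(2) r_cancel_one[OF a(1) N_closed[OF n(1)]] by blast
qed

section \<open>Reduced words and the ping-pong sets\<close>

abbreviation RW :: "('i \<times> 'a) list set" where
  "RW \<equiv> reduced_words I (\<lambda>j. G\<lparr>carrier := S j\<rparr>)"

abbreviation ev :: "('i \<times> 'a) list \<Rightarrow> 'a" where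
  "ev \<equiv> free_product_lift G (\<lambda>j a. a)"

lemma ev_simps [simp]: "ev [] = \<one>" "ev ((j, a) # w) = a \<otimes> ev w"
  by (simp_all add: free_product_lift_def)

lemma RW_append:
  "u @ v \<in> RW \<longleftrightarrow> u \<in> RW \<and> v \<in> RW \<and> (u = [] \<or> v = [] \<or> fst (last u) \<noteq> fst (hd v))"
  by (auto simp: reduced_words_def distinct_adj_append_iff last_map hd_map)

lemma RW_Cons:
  "(j, a) # w \<in> RW \<longleftrightarrow>
     j \<in> I \<and> a \<in> S j \<and> a \<noteq> \<one> \<and> w \<in> RW \<and> (w = [] \<or> fst (hd w) \<noteq> j)"
  by (simp add: reduced_words_Cons)

lemma ev_closed: "w \<in> RW \<Longrightarrow> ev w \<in> carrier G"
proof (induction w)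
  case (Cons p w)
  then show ?case by (cases p) (auto simp: RW_Cons S_closed)
qed simp

lemma ev_append: "u \<in> RW \<Longrightarrow> v \<in> RW \<Longrightarrow> ev (u @ v) = ev u \<otimes> ev v"
proof (induction u)
  case (Cons p u)
  then show ?case by (cases p) (auto simp: RW_Cons S_closed ev_closed m_assoc)
qed (simp add: ev_closed)

lemma ex1_RW: "g \<in> carrier G \<Longrightarrow> \<exists>!w. w \<in> RW \<and> ev w = g"
  using fp by (simp add: is_free_product_def)

lemma ev_inj: "u \<in> RW \<Longrightarrow> v \<in> RW \<Longrightarrow> ev u = ev v \<Longrightarrow> u = v"
  using ex1_RW[OF ev_closed, of v] by blast

lemma ev_surj:
  assumes "g \<in> carrier G"
  obtains w where "w \<in> RW" "ev w = g"
  using ex1_RW[OF assms] by blast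


definition rep_letter :: "'i \<times> 'a \<Rightarrow> bool" where
  "rep_letter p \<longleftrightarrow> (fst p = i \<longrightarrow> rep (snd p) = snd p)"

definition W :: "('i \<times> 'a) list set" where
  "W = {w \<in> RW. \<forall>p\<in>set w. rep_letter p}"

text \<open>
  The words of \<open>T\<close> represent the double cosets of the normal closure of \<open>N\<close> and the factor
  \<open>S i\<close>; a final \<open>i\<close>-letter is excluded because it would normalise \<open>N\<close> and give the same conjugate again.
\<close>
definition T :: "('i \<times> 'a) list set" where
  "T = {w \<in> W. w = [] \<or> fst (last w) \<noteq> i}"

definition X :: "('i \<times> 'a) list \<Rightarrow> 'a set" where
  "X t = {ev (t @ (i, a) # w) | a w. t @ (i, a) # w \<in> RW \<and> rep a \<noteq> a}"

definition conj :: "('i \<times> 'a) list \<Rightarrow> 'a \<Rightarrow> 'a" where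
  "conj t n = ev t \<otimes> n \<otimes> inv (ev t)"

lemma Nil_in_T: "[] \<in> T"
  by (simp add: T_def W_def)

lemma T_RW: "t \<in> T \<Longrightarrow> t \<in> RW"
  by (simp add: T_def W_def)

text \<open>
  The index \<open>t\<close> is determined by the reduced word of an element of \<open>X t\<close>: it is the part before
  the first letter outside the transversal.
\<close>
lemma X_disjoint:
  assumes "t \<in> T" "t' \<in> T" "t \<noteq> t'"
  shows "X t \<inter> X t' = {}"
proof (rule ccontr)
  assume "X t \<inter> X t' \<noteq> {}"
  then obtain g where g: "g \<in> X t" "g \<in> X t'" by auto
  obtain a v where 1: "t @ (i, a) # v \<in> RW" "rep a \<noteq> a" "g = ev (t @ (i, a) # v)"
    using g(1) by (auto simp: X_def)
  obtain b w where 2: "t' @ (i, b) # w \<in> RW" "rep b \<noteq> b" "g = ev (t' @ (i, b) # w)"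
    using g(2) by (auto simp: X_def)
  have tw: "takeWhile rep_letter (u @ (i, c) # z) = u" if "u \<in> T" "rep c \<noteq> c" for u c z
    using that by (simp add: T_def W_def rep_letter_def)
  have "t @ (i, a) # v = t' @ (i, b) # w" using ev_inj[OF 1(1) 2(1)] 1(3) 2(3) by simp
  then show False using tw[OF assms(1) 1(2)] tw[OF assms(2) 2(2)] assms(3) by metis
qed

lemma one_notin_X: "\<one> \<notin> X t"
proof
  assume "\<one> \<in> X t"
  then obtain a w where "t @ (i, a) # w \<in> RW" "ev (t @ (i, a) # w) = ev []"
    unfolding X_def by auto
  then show False using ev_inj[of "t @ (i, a) # w" "[]"] by simp
qed

lemma conj_hom:
  assumes "t \<in> T"
  shows "conj t \<in> hom (G\<lparr>carrier := N\<rparr>) G"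
proof (rule homI)
  have t: "ev t \<in> carrier G" using ev_closed T_RW assms by blast
  show "conj t n \<in> carrier G" if "n \<in> carrier (G\<lparr>carrier := N\<rparr>)" for n
    using that t N_closed by (simp add: conj_def)
  show "conj t (m \<otimes>\<^bsub>G\<lparr>carrier := N\<rparr>\<^esub> n) = conj t m \<otimes> conj t n"
    if "m \<in> carrier (G\<lparr>carrier := N\<rparr>)" "n \<in> carrier (G\<lparr>carrier := N\<rparr>)" for m n
  proof -
    have mn: "m \<in> carrier G" "n \<in> carrier G" using that N_closed by auto
    have "inv (ev t) \<otimes> (ev t \<otimes> (n \<otimes> inv (ev t))) = n \<otimes> inv (ev t)"
      using mn t by (simp add: m_assoc[symmetric])
    then show ?thesis using mn t by (simp add: conj_def m_assoc)
  qed
qed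

text \<open>
  Write \<open>g = t w\<close> with \<open>w\<close> reduced. If \<open>w\<close> starts with an \<open>i\<close>-letter \<open>a\<close>, then \<open>t w\<close> is already
  reduced, as \<open>t\<close> does not end in an \<open>i\<close>-letter; so \<open>a\<close> is in the transversal because \<open>g \<notin> X t\<close>, and \<open>n a\<close> is
  not. Otherwise \<open>t n w\<close> is reduced and \<open>n\<close> is outside the transversal. Cancellation between \<open>t\<close> and \<open>w\<close>
  in the second case is harmless, since \<open>n\<close> is put between them.
\<close>
lemma conj_moves_into_X:
  assumes t: "t \<in> T" and n: "n \<in> N" "n \<noteq> \<one>" and g: "g \<in> carrier G" "g \<notin> X t"
  shows "conj t n \<otimes> g \<in> X t"
proof -
  have tR: "t \<in> RW" and tc: "ev t \<in> carrier G" using T_RW ev_closed t by auto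
  have tl: "t = [] \<or> fst (last t) \<noteq> i" using t by (simp add: T_def)
  have nc: "n \<in> carrier G" and nS: "n \<in> S i" using n N_closed N_sub_S by auto
  obtain w where w: "w \<in> RW" "ev w = inv (ev t) \<otimes> g" using ev_surj g tc by (metis inv_closed m_closed)
  have g_eq: "g = ev t \<otimes> ev w" using w g tc by (simp add: m_assoc[symmetric])
  have eq: "conj t n \<otimes> g = ev t \<otimes> (n \<otimes> ev w)"
    using w g tc nc by (simp add: conj_def m_assoc)
  show ?thesis
  proof (cases "w \<noteq> [] \<and> fst (hd w) = i")
    case True
    then obtain a v where wv: "w = (i, a) # v" by (cases w) auto
    have a: "a \<in> S i" "a \<noteq> \<one>" "a \<in> carrier G" and v: "v \<in> RW" "v = [] \<or> fst (hd v) \<noteq> i"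
      using w wv S_closed iI by (auto simp: RW_Cons)
    have red: "t @ (i, a) # v \<in> RW" using tR w wv tl by (auto simp: RW_append)
    have "g = ev (t @ (i, a) # v)" using g_eq ev_append[OF tR, of w] w wv by simp
    then have "rep a = a" using g red unfolding X_def by blast
    then have moved: "rep (n \<otimes> a) \<noteq> n \<otimes> a" using rep_moved n a by blast
    have nz: "n \<otimes> a \<noteq> \<one>" using moved rep_one by metis
    have "n \<otimes> a \<in> S i" by (rule subgroup.m_closed[OF S_subgroup[OF iI] nS a(1)])
    then have red1: "(i, n \<otimes> a) # v \<in> RW" using nz v iI by (simp add: RW_Cons)
    then have red': "t @ (i, n \<otimes> a) # v \<in> RW" using tR tl by (auto simp: RW_append)
    have "conj t n \<otimes> g = ev (t @ (i, n \<otimes> a) # v)"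
      using eq ev_append[OF tR red1] wv nc a ev_closed[OF v(1)] by (simp add: m_assoc)
    then show ?thesis using red' moved unfolding X_def by blast
  next
    case False
    have red1: "(i, n) # w \<in> RW" using False w n nS iI by (auto simp: RW_Cons)
    then have red: "t @ (i, n) # w \<in> RW" using tR tl by (auto simp: RW_append)
    moreover have "rep n \<noteq> n" using rep_N n by metis
    moreover have "conj t n \<otimes> g = ev (t @ (i, n) # w)"
      using eq ev_append[OF tR red1] by simp
    ultimately show ?thesis unfolding X_def by blast
  qed
qed

section \<open>The complement and the injectivity of the induced homomorphism\<close>

text \<open>
  The subgroup generated by the conjugates \<open>t N t\<^sup>-\<^sup>1\<close> with \<open>t \<noteq> 1\<close>, given as the image of their free
  product so that its elements come with reduced words to which ping-pong applies.
\<close>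
definition K :: "'a set" where
  "K = free_product_lift G conj ` reduced_words (T - {[]}) (\<lambda>_. G\<lparr>carrier := N\<rparr>)"

lemma N_group: "group (G\<lparr>carrier := N\<rparr>)"
  by (rule subgroup_imp_group[OF N_subgroup])

lemma K_subgroup: "subgroup K G"
proof -
  interpret group_hom "free_product (T - {[]}) (\<lambda>_. G\<lparr>carrier := N\<rparr>)" G "free_product_lift G conj"
    unfolding group_hom_def group_hom_axioms_def
    using group_free_product[of "T - {[]}" "\<lambda>_. G\<lparr>carrier := N\<rparr>"] N_group group_axioms
      free_product_lift_hom[of "T - {[]}" "\<lambda>_. G\<lparr>carrier := N\<rparr>" G conj] conj_hom by simp
  show ?thesis using img_is_subgroup by (simp add: K_def free_product_def)
qed

lemma conj_in_K:
  assumes t: "t \<in> T" "t \<noteq> []" and n: "n \<in> N"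
  shows "conj t n \<in> K"
proof -
  let ?F = "\<lambda>_. G\<lparr>carrier := N\<rparr>"
  have "free_product_lift G conj (free_product_inj ?F t n) = conj t n"
    by (rule free_product_lift_inj[where I = "T - {[]}"])
      (use N_group group_axioms conj_hom t n in auto)
  moreover have "free_product_inj ?F t n \<in> reduced_words (T - {[]}) ?F"
    using hom_in_carrier[OF free_product_inj_hom[of "T - {[]}" ?F t]] N_group t n
    by (simp add: free_product_def)
  ultimately show ?thesis unfolding K_def by force
qed

text \<open>
  First round of ping-pong, among the conjugates that generate \<open>K\<close>: the result lies in the set of
  the first letter.
\<close>
lemma K_moves_into_X:
  assumes k: "k \<in> K" "k \<noteq> \<one>" and g: "g \<in> carrier G" "g \<notin> (\<Union>t\<in>T - {[]}. X t)"
  shows "k \<otimes> g \<in> (\<Union>t\<in>T - {[]}. X t)"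
proof -
  let ?F = "\<lambda>_. G\<lparr>carrier := N\<rparr>"
  obtain w where w: "w \<in> reduced_words (T - {[]}) ?F" "k = free_product_lift G conj w"
    using k unfolding K_def by blast
  have ne: "w \<noteq> []" using k w by (auto simp: free_product_lift_def)
  have "free_product_lift G conj w \<otimes> g \<in> X (fst (hd w))"
  proof (rule ping_pong[where J = "T - {[]}" and F = ?F and \<phi> = conj and X = X])
    show "conj t \<in> hom (?F t) G" if "t \<in> T - {[]}" for t using conj_hom that by simp
    show "conj t n \<otimes> h \<in> X t"
      if "t \<in> T - {[]}" "n \<in> carrier (?F t)" "n \<noteq> \<one>\<^bsub>?F t\<^esub>" "h \<in> carrier G" "h \<notin> X t" for t n h
      using conj_moves_into_X that by simp
    show "X s \<inter> X t = {}" if "s \<in> T - {[]}" "t \<in> T - {[]}" "s \<noteq> t" for s t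
      using X_disjoint that by simp
    show "g \<notin> X t" if "t \<in> T - {[]}" for t using g that by blast
  qed (use group_axioms N_group g w ne in simp_all)
  moreover have "fst (hd w) \<in> T - {[]}"
    using w ne by (cases w) (auto simp: reduced_words_def)
  ultimately show ?thesis using w by blast
qed


abbreviation NK :: "bool \<Rightarrow> ('a, 'b) monoid_scheme" where
  "NK \<equiv> \<lambda>b. G\<lparr>carrier := (if b then N else K)\<rparr>"

abbreviation ev2 :: "(bool \<times> 'a) list \<Rightarrow> 'a" where
  "ev2 \<equiv> free_product_lift G (\<lambda>b a. a)"

definition M :: "'a set" where
  "M = ev2 ` reduced_words UNIV NK"

lemma NK_group: "group (NK b)"
  using subgroup_imp_group N_subgroup K_subgroup by simp

lemma NK_hom: "(\<lambda>a. a) \<in> hom (NK b) G"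
  using N_subgroup K_subgroup by (auto intro!: homI dest: subgroup.mem_carrier)

lemma ev2_hom: "ev2 \<in> hom (free_product UNIV NK) G"
  by (rule free_product_lift_hom) (use NK_group NK_hom group_axioms in auto)

text \<open>
  Second round, with \<open>N\<close> playing for \<open>X []\<close> and \<open>K\<close> for the union of the other sets. The identity lies in
  none of them and is moved into one by every nonempty reduced word.
\<close>
lemma ev2_inj: "inj_on ev2 (reduced_words UNIV NK)"
proof (rule free_product_lift_trivial_kernel_inj)
  fix w assume w: "w \<in> reduced_words UNIV NK" "w \<noteq> []"
  let ?X = "\<lambda>b. if b then X [] else (\<Union>t\<in>T - {[]}. X t)"
  have one_notin: "\<one> \<notin> ?X b" for b using one_notin_X by simp
  have "ev2 w \<otimes> \<one> \<in> ?X (fst (hd w))"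
  proof (rule ping_pong[where J = UNIV and F = NK and X = ?X])
    show "a \<otimes> g \<in> ?X b"
      if "a \<in> carrier (NK b)" "a \<noteq> \<one>\<^bsub>NK b\<^esub>" "g \<in> carrier G" "g \<notin> ?X b" for b a g
    proof (cases b)
      case True
      then show ?thesis
        using conj_moves_into_X[OF Nil_in_T, of a g] that N_closed by (simp add: conj_def)
    next
      case False
      then show ?thesis using K_moves_into_X[of a g] that by simp
    qed
    show "?X b \<inter> ?X c = {}" if "b \<noteq> c" for b c
      using that X_disjoint[OF Nil_in_T] by (cases b; cases c) fastforce+
  qed (use group_axioms NK_group NK_hom w one_notin in blast)+
  moreover have "ev2 w \<in> carrier G"
    using hom_in_carrier[OF ev2_hom] w by (simp add: free_product_def)
  ultimately show "ev2 w \<noteq> \<one>" using one_notin[of "fst (hd w)"] by auto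
qed (use group_axioms NK_group NK_hom in auto)

lemma M_subgroup: "subgroup M G"
proof -
  interpret group_hom "free_product UNIV NK" G ev2
    unfolding group_hom_def group_hom_axioms_def
    using group_free_product[of UNIV NK] NK_group group_axioms ev2_hom by simp
  show ?thesis using img_is_subgroup by (simp add: M_def free_product_def)
qed

lemma NK_sub_M:
  assumes "a \<in> carrier (NK b)"
  shows "a \<in> M"
proof -
  have "ev2 (free_product_inj NK b a) = a"
    by (rule free_product_lift_inj[where I = UNIV]) (use NK_group NK_hom group_axioms assms in auto)
  moreover have "free_product_inj NK b a \<in> reduced_words UNIV NK"
    using hom_in_carrier[OF free_product_inj_hom[of UNIV NK b]] NK_group assms
    by (simp add: free_product_def)
  ultimately show ?thesis unfolding M_def by force
qed

lemma N_sub_M: "n \<in> N \<Longrightarrow> n \<in> M"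
  using NK_sub_M[of n True] by simp

lemma K_sub_M: "k \<in> K \<Longrightarrow> k \<in> M"
  using NK_sub_M[of k False] by simp

section \<open>The subgroup generated by both factors is the normal closure\<close>

lemma conj_in_M:
  assumes "t \<in> T" "n \<in> N"
  shows "conj t n \<in> M"
proof (cases "t = []")
  case True
  then show ?thesis using assms N_sub_M N_closed by (simp add: conj_def)
next
  case False
  then show ?thesis using conj_in_K K_sub_M assms by blast
qed

lemma M_closed: "m \<in> M \<Longrightarrow> m \<in> carrier G"
  by (rule subgroup.mem_carrier[OF M_subgroup])

text \<open>
  For \<open>j = i\<close> split \<open>b = n s\<close> with \<open>n \<in> N\<close> and \<open>s\<close> in the transversal: \<open>u b = (u n u\<^sup>-\<^sup>1) u s\<close>, where \<open>u\<close> is in \<open>T\<close>, so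
  that the first factor is in \<open>M\<close>. If \<open>s = 1\<close>, no letter is appended.
\<close>
lemma snoc_letter_in_M_W:
  assumes u: "u \<in> W" "u = [] \<or> fst (last u) \<noteq> j" and j: "j \<in> I" "b \<in> S j"
  shows "\<exists>m\<in>M. \<exists>v\<in>W. ev u \<otimes> b = m \<otimes> ev v"
proof -
  have uR: "u \<in> RW" and ug: "\<And>p. p \<in> set u \<Longrightarrow> rep_letter p" using u by (auto simp: W_def)
  have uc: "ev u \<in> carrier G" using ev_closed uR .
  have snoc: "\<exists>v\<in>W. ev u \<otimes> c = ev v" if c: "c \<in> S j" "rep_letter (j, c)" for c
  proof (cases "c = \<one>")
    case True
    then show ?thesis using u uc by auto
  next
    case False
    have r: "[(j, c)] \<in> RW" using False j c by (simp add: RW_Cons)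
    then have "u @ [(j, c)] \<in> RW" using uR u by (auto simp: RW_append)
    then have "u @ [(j, c)] \<in> W" using ug c by (auto simp: W_def)
    moreover have "ev (u @ [(j, c)]) = ev u \<otimes> c"
      using ev_append[OF uR r] S_closed j c by simp
    ultimately show ?thesis by metis
  qed
  show ?thesis
  proof (cases "j = i")
    case False
    then have "rep_letter (j, b)" by (simp add: rep_letter_def)
    then obtain v where v: "v \<in> W" "ev u \<otimes> b = ev v" using snoc j by blast
    moreover have "ev v = \<one> \<otimes> ev v" using v ev_closed[of v] by (simp add: W_def)
    then show ?thesis using v subgroup.one_closed[OF M_subgroup] by metis
  next
    case True
    then have uT: "u \<in> T" using u by (simp add: T_def)
    obtain n where n: "n \<in> N" "b = n \<otimes> rep b" "rep b \<in> S i" "rep (rep b) = rep b"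
      using rep_decomp[of b] j True by blast
    obtain v where v: "v \<in> W" "ev u \<otimes> rep b = ev v"
      using snoc[of "rep b"] n True by (auto simp: rep_letter_def)
    have nc: "n \<in> carrier G" "rep b \<in> carrier G" using n N_closed S_closed iI by auto
    have "inv (ev u) \<otimes> (ev u \<otimes> rep b) = rep b"
      using nc uc by (simp add: m_assoc[symmetric])
    then have "conj u n \<otimes> ev v = ev u \<otimes> (n \<otimes> rep b)"
      using nc uc v(2)[symmetric] by (simp add: conj_def m_assoc)
    then show ?thesis using n(2) conj_in_M[OF uT n(1)] v by metis
  qed
qed

text \<open>
  If \<open>u\<close> ends with a \<open>j\<close>-letter, that letter is removed and merged with \<open>b\<close> before appending.
\<close>
lemma W_mult_letter:
  assumes u: "u \<in> W" and j: "j \<in> I" "b \<in> S j"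
  shows "\<exists>m\<in>M. \<exists>v\<in>W. ev u \<otimes> b = m \<otimes> ev v"
proof (cases "u = [] \<or> fst (last u) \<noteq> j")
  case True
  then show ?thesis using snoc_letter_in_M_W u j by blast
next
  case False
  then obtain u0 c where uc: "u = u0 @ [(j, c)]"
    by (cases u rule: rev_cases) auto
  have red: "u0 \<in> RW" "[(j, c)] \<in> RW" "u0 = [] \<or> fst (last u0) \<noteq> j" "c \<in> S j"
    and u0: "u0 \<in> W"
    using u uc by (auto simp: W_def RW_append RW_Cons)
  have cb: "c \<otimes> b \<in> S j" by (rule subgroup.m_closed[OF S_subgroup[OF j(1)] red(4) j(2)])
  have "ev u \<otimes> b = ev u0 \<otimes> (c \<otimes> b)"
    using ev_append[OF red(1,2)] uc red j S_closed ev_closed[OF red(1)] by (simp add: m_assoc)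
  then show ?thesis using snoc_letter_in_M_W[OF u0 red(3) j(1) cb] by simp
qed

lemma M_W_cover:
  assumes "g \<in> carrier G"
  shows "\<exists>m\<in>M. \<exists>u\<in>W. g = m \<otimes> ev u"
proof -
  have "w \<in> RW \<Longrightarrow> u \<in> W \<Longrightarrow> \<exists>m\<in>M. \<exists>v\<in>W. ev u \<otimes> ev w = m \<otimes> ev v" for w u
  proof (induction w arbitrary: u)
    case Nil
    have "ev u \<otimes> ev [] = \<one> \<otimes> ev u" using Nil ev_closed[of u] by (simp add: W_def)
    then show ?case using subgroup.one_closed[OF M_subgroup] Nil.prems(2) by blast
  next
    case (Cons p w)
    obtain j b where p: "p = (j, b)" by (cases p)
    have j: "j \<in> I" "b \<in> S j" and w: "w \<in> RW" using Cons.prems p by (auto simp: RW_Cons)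
    obtain m v where m: "m \<in> M" "v \<in> W" "ev u \<otimes> b = m \<otimes> ev v"
      using W_mult_letter[OF Cons.prems(2) j] by blast
    obtain m' v' where m': "m' \<in> M" "v' \<in> W" "ev v \<otimes> ev w = m' \<otimes> ev v'"
      using Cons.IH[OF w m(2)] by blast
    have c: "ev u \<in> carrier G" "ev v \<in> carrier G" "ev v' \<in> carrier G" "ev w \<in> carrier G"
        "b \<in> carrier G" "m \<in> carrier G" "m' \<in> carrier G"
      using ev_closed Cons.prems m m' w S_closed[OF j] M_closed by (auto simp: W_def)
    have "ev u \<otimes> ev (p # w) = (m \<otimes> ev v) \<otimes> ev w"
      using p m(3)[symmetric] c by (simp add: m_assoc)
    also have "\<dots> = (m \<otimes> m') \<otimes> ev v'" using m'(3) c by (simp add: m_assoc)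
    finally show ?case using m m' subgroup.m_closed[OF M_subgroup] by blast
  qed
  moreover obtain w where "w \<in> RW" "ev w = g" using ev_surj assms by blast
  moreover have "[] \<in> W" by (simp add: W_def)
  ultimately show ?thesis using assms by fastforce
qed

text \<open>
  A final \<open>i\<close>-letter of \<open>u\<close> normalises \<open>N\<close> and can be dropped, which leaves a word of \<open>T\<close>.
\<close>
lemma W_conj_N:
  assumes u: "u \<in> W" and n: "n \<in> N"
  shows "ev u \<otimes> n \<otimes> inv (ev u) \<in> M"
proof (cases "u \<in> T")
  case True
  then show ?thesis using conj_in_M n by (simp add: conj_def)
next
  case False
  then obtain u0 a where ua: "u = u0 @ [(i, a)]"
    using u by (cases u rule: rev_cases) (auto simp: T_def)
  have red: "u0 \<in> RW" "[(i, a)] \<in> RW" "a \<in> S i" and T: "u0 \<in> T"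
    using u ua by (auto simp: W_def T_def RW_append RW_Cons)
  have c: "ev u0 \<in> carrier G" "a \<in> carrier G" "n \<in> carrier G"
    using ev_closed red S_closed iI N_closed n by auto
  have "ev u \<otimes> n \<otimes> inv (ev u) = conj u0 (a \<otimes> n \<otimes> inv a)"
    using ua ev_append[OF red(1,2)] c by (simp add: conj_def m_assoc inv_mult_group)
  then show ?thesis using conj_in_M[OF T N_conj[OF red(3) n]] by simp
qed

lemma conj_N_in_M:
  assumes g: "g \<in> carrier G" and n: "n \<in> N"
  shows "g \<otimes> n \<otimes> inv g \<in> M"
proof -
  obtain m u where m: "m \<in> M" "u \<in> W" "g = m \<otimes> ev u" using M_W_cover g by blast
  have c: "m \<in> carrier G" "ev u \<in> carrier G" "n \<in> carrier G"
    using m M_closed ev_closed N_closed n by (auto simp: W_def)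
  have "g \<otimes> n \<otimes> inv g = m \<otimes> (ev u \<otimes> n \<otimes> inv (ev u)) \<otimes> inv m"
    using m c by (simp add: m_assoc inv_mult_group)
  then show ?thesis
    using subgroup.m_closed[OF M_subgroup subgroup.m_closed[OF M_subgroup m(1) W_conj_N[OF m(2) n]]
        subgroup.m_inv_closed[OF M_subgroup m(1)]] by simp
qed

lemma normal_conj_mem:
  assumes "L \<lhd> G" "N \<subseteq> L" "g \<in> carrier G" "n \<in> N"
  shows "g \<otimes> n \<otimes> inv g \<in> L"
  using normal.inv_op_closed2[OF assms(1,3)] assms by blast

lemma M_least:
  assumes L: "L \<lhd> G" "N \<subseteq> L"
  shows "M \<subseteq> L"
proof -
  have Ls: "subgroup L G" using L normal_imp_subgroup by blast
  have conj_L: "conj t n \<in> L" if "t \<in> T" "n \<in> N" for t n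
    using normal_conj_mem[OF L ev_closed[OF T_RW]] that by (simp add: conj_def)
  have K: "K \<subseteq> L"
    using free_product_lift_in_subgroup[OF Ls] conj_L unfolding K_def by force
  show ?thesis
    unfolding M_def
  proof (intro image_subsetI)
    fix w assume "w \<in> reduced_words UNIV NK"
    then show "ev2 w \<in> L"
      by (rule free_product_lift_in_subgroup[OF Ls]) (use K L(2) in \<open>auto split: if_splits\<close>)
  qed
qed

text \<open>
  The subgroup generated by all conjugates of \<open>N\<close> is normal, and it coincides with \<open>M\<close>: it contains
  \<open>M\<close> by minimality of \<open>M\<close>, and it is contained in \<open>M\<close> because all conjugates of \<open>N\<close> are.
\<close>
lemma M_normal: "M \<lhd> G"
proof -
  let ?C = "{g \<otimes> n \<otimes> inv g | g n. g \<in> carrier G \<and> n \<in> N}"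
  have C: "?C \<subseteq> carrier G" using N_closed by auto
  have "h \<otimes> c \<otimes> inv h \<in> ?C" if c: "c \<in> ?C" and h: "h \<in> carrier G" for c h
  proof -
    obtain g n where g: "g \<in> carrier G" "n \<in> N" "c = g \<otimes> n \<otimes> inv g" using c by blast
    then have "h \<otimes> c \<otimes> inv h = (h \<otimes> g) \<otimes> n \<otimes> inv (h \<otimes> g)"
      using h N_closed by (simp add: m_assoc inv_mult_group)
    moreover have "h \<otimes> g \<in> carrier G" using g h by simp
    ultimately show ?thesis using g(2) by blast
  qed
  then have normal: "generate G ?C \<lhd> G" using normal_generateI[OF C] by blast
  have "n \<in> ?C" if "n \<in> N" for n
  proof -
    have "n = \<one> \<otimes> n \<otimes> inv \<one>" using N_closed[OF that] by simp
    then show ?thesis using that one_closed by blast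
  qed
  then have "N \<subseteq> generate G ?C" by (intro subsetI generate.incl)
  then have "M \<subseteq> generate G ?C" by (rule M_least[OF normal])
  moreover have "generate G ?C \<subseteq> M"
    by (rule generate_subgroup_incl[OF _ M_subgroup]) (use conj_N_in_M in blast)
  ultimately have "M = generate G ?C" by (rule subset_antisym)
  then show ?thesis using normal by (simp only:)
qed

lemma normal_closure_eq_M: "normal_closure G N = M"
  using M_least M_normal N_sub_M unfolding normal_closure_def by blast

lemma free_product2_N_K: "is_free_product2 (G\<lparr>carrier := M\<rparr>) N K"
proof -
  have "ev2 \<in> hom (free_product UNIV NK) (G\<lparr>carrier := M\<rparr>)"
    using ev2_hom by (auto simp: hom_def M_def free_product_def)
  then have "ev2 \<in> iso (free_product UNIV NK) (G\<lparr>carrier := M\<rparr>)"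
    using ev2_inj by (simp add: iso_def bij_betw_def M_def free_product_def)
  moreover have "free_product_lift (G\<lparr>carrier := M\<rparr>) (\<lambda>b a. a) = ev2"
    by (simp add: free_product_lift_def fun_eq_iff)
  ultimately show ?thesis by (simp add: is_free_product2_def)
qed

end

section \<open>Existence and uniqueness of the complement\<close>

theorem mainTheorem1:
  fixes G :: "('a, 'c) monoid_scheme" and I :: "'i set" and S :: "'i \<Rightarrow> 'a set"
    and i :: 'i and N :: "'a set"
  assumes "is_free_product G I S"
    and "\<And>j. j \<in> I \<Longrightarrow> S j \<noteq> {\<one>\<^bsub>G\<^esub>}"
    and "i \<in> I"
    and "N \<lhd> G\<lparr>carrier := S i\<rparr>"
    and "N \<noteq> {\<one>\<^bsub>G\<^esub>}"
  defines "H \<equiv> G\<lparr>carrier := normal_closure G N\<rparr>"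
  shows "(\<exists>K. subgroup K H \<and> is_free_product2 H N K) \<and>
         (\<forall>K K'. subgroup K H \<and> is_free_product2 H N K \<and>
                 subgroup K' H \<and> is_free_product2 H N K' \<longrightarrow>
                 G\<lparr>carrier := K\<rparr> \<cong> G\<lparr>carrier := K'\<rparr>)"
proof -
  interpret group G using assms(1) by (simp add: is_free_product_def)
  interpret normal_subgroup_of_free_factor G I S i N
    using assms by (intro normal_subgroup_of_free_factor.intro
        normal_subgroup_of_free_factor_axioms.intro group_axioms)
  have H_eq: "H = G\<lparr>carrier := M\<rparr>" by (simp add: H_def normal_closure_eq_M)
  have H: "group H" using subgroup_imp_group M_subgroup H_eq by simp
  have N_H: "subgroup N H"
    using subgroup_incl[OF N_subgroup M_subgroup] N_sub_M H_eq by auto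
  have "subgroup K H"
    using subgroup_incl[OF K_subgroup M_subgroup] K_sub_M H_eq by auto
  moreover have "is_free_product2 H N K" using free_product2_N_K H_eq by simp
  moreover have "G\<lparr>carrier := A\<rparr> \<cong> G\<lparr>carrier := B\<rparr>"
    if "subgroup A H" "is_free_product2 H N A" "subgroup B H" "is_free_product2 H N B" for A B
    using free_product2_complement_unique[OF H N_H that] by (simp add: H_eq)
  ultimately show ?thesis by blast
qed

end
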